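(* Consider a contextual bandit with $K\ge 2$ arms and $N\ge 2$ experts, one of which is the uniform expert, and suppose all rewards satisfy $0\le r^t_j\le 1$ for every arm $j$ and every step $t$. For any fixed time horizon $T>0$ and any $0<\delta<1$, let EXP4.P be run with $\gamma=\sqrt{\frac{3K\ln N}{T\left(\frac{2N}{3}+1\right)}}\le \frac12$ and $\alpha=2\sqrt{K\ln\frac{NT}{\delta}}$. Then, with probability at least $1-\delta$, $$R_T\le 2\sqrt{3KT\Big(\tfrac{2N}{3}+1\Big)\ln N}+4K\sqrt{KNT\ln\Big(\tfrac{NT}{\delta}\Big)}+8NK\ln\Big(\tfrac{NT}{\delta}\Big).$$
   Context: Contextual bandit with experts. There are $K$ arms, $N$ experts and a time horizon $T$. At each step $t=1,\dots,T$ a context $c_t$ is generated; each expert $i$ outputs, based on $c_t$, a probability vector $\xi_i(t)=(\xi_i^1(t),\dots,\xi_i^K(t))$ over the arms; there is a reward vector $x(t)=r^t=(r^t_1,\dots,r^t_K)$, which may be chosen arbitrarily in the stated range; the player pulls an arm $i_t$ and receives (and observes only) $y_t=r^t_{i_t}$. The uniform expert is the expert with $\xi^j(t)=1/K$ for all $j,t$. Reward of expert $i$: $G_i=\sum_{t=1}^T \xi_i(t)^{\top}x(t)$. Regret: $R_T=\max_{1\le i\le N}G_i-\sum_{t=1}^T y_t$. Algorithm EXP4.P with parameters $\alpha>0$, $\gamma\in(0,1)$: initialize $w_i(1)=\exp\left(\frac{\alpha\gamma}{3K}\sqrt{NT}\right)$ for $i=1,\dots,N$. For $t=1,\dots,T$: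 set $p_j(t)=(1-\gamma)\sum_{i=1}^N\frac{w_i(t)\xi_i^j(t)}{\sum_{l=1}^N w_l(t)}+\frac{\gamma}{K}$ for $j=1,\dots,K$; draw $i_t$ from the distribution $(p_1(t),\dots,p_K(t))$; receive $x_{i_t}(t)$; set $\hat x_j(t)=\frac{x_j(t)}{p_j(t)}\mathbf 1_{j=i_t}$ and $\hat z_i(t)=\xi_i(t)^{\top}\hat x(t)$; update $$w_i(t+1)=w_i(t)\exp\left(\frac{\gamma}{3K}\left(\hat z_i(t)+\frac{\alpha}{\left(\frac{w_i(t)}{\sum_{l=1}^N w_l(t)}+\frac{\gamma}{K}\right)\sqrt{NT}}\right)\right).$$ *)

theory Defs
  imports "HOL-Probability.Probability"
begin

text \<open>
  Arms, experts and time steps are numbered from 0, that is by \<open>{..<K}\<close>, \<open>{..<N}\<close> and \<open>{..<T}\<close>;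
  step \<open>t\<close> here is step \<open>t + 1\<close> in 1-based numbering.

  The algorithm EXP4.P is described pathwise.  Along a path, \<open>e t i j\<close> is the weight that
  expert \<open>i\<close> puts on arm \<open>j\<close> at step \<open>t\<close>, \<open>x t j\<close> is the reward of arm \<open>j\<close> and \<open>a t\<close> is the
  arm pulled.
\<close>

definition exp4p_prob ::
    "nat \<Rightarrow> nat \<Rightarrow> real \<Rightarrow> (nat \<Rightarrow> nat \<Rightarrow> real) \<Rightarrow> (nat \<Rightarrow> real) \<Rightarrow> nat \<Rightarrow> real" where
  "exp4p_prob K N \<gamma> e w j =
     (1 - \<gamma>) * (\<Sum>i<N. w i * e i j / (\<Sum>l<N. w l)) + \<gamma> / real K"

text \<open>Only the reward of the pulled arm \<open>a\<close> enters the following estimate of the reward vector.\<close>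

definition exp4p_reward_est :: "(nat \<Rightarrow> real) \<Rightarrow> (nat \<Rightarrow> real) \<Rightarrow> nat \<Rightarrow> nat \<Rightarrow> real" where
  "exp4p_reward_est p x a j = x j / p j * indicator {a} j"

definition exp4p_gain_est ::
    "nat \<Rightarrow> (nat \<Rightarrow> nat \<Rightarrow> real) \<Rightarrow> (nat \<Rightarrow> real) \<Rightarrow> (nat \<Rightarrow> real) \<Rightarrow> nat \<Rightarrow> nat \<Rightarrow> real" where
  "exp4p_gain_est K e p x a i = (\<Sum>j<K. e i j * exp4p_reward_est p x a j)"

text \<open>\<open>exp4p_weight K N T \<alpha> \<gamma> e x a t\<close> is the weight vector in force at step \<open>t\<close>;
  it depends only on what happened at the steps before \<open>t\<close>.\<close>

primrec exp4p_weight ::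
    "nat \<Rightarrow> nat \<Rightarrow> nat \<Rightarrow> real \<Rightarrow> real \<Rightarrow> (nat \<Rightarrow> nat \<Rightarrow> nat \<Rightarrow> real) \<Rightarrow> (nat \<Rightarrow> nat \<Rightarrow> real) \<Rightarrow>
     (nat \<Rightarrow> nat) \<Rightarrow> nat \<Rightarrow> nat \<Rightarrow> real" where
  "exp4p_weight K N T \<alpha> \<gamma> e x a 0 =
     (\<lambda>i. exp (\<alpha> * \<gamma> / (3 * real K) * sqrt (real N * real T)))"
| "exp4p_weight K N T \<alpha> \<gamma> e x a (Suc t) =
     (let w = exp4p_weight K N T \<alpha> \<gamma> e x a t;
          p = exp4p_prob K N \<gamma> (e t) w
      in (\<lambda>i. w i * exp (\<gamma> / (3 * real K) *
           (exp4p_gain_est K (e t) p (x t) (a t) i +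
            \<alpha> / ((w i / (\<Sum>l<N. w l) + \<gamma> / real K) * sqrt (real N * real T))))))"

text \<open>
  The \<open>\<sigma>\<close>-algebra \<open>F t\<close> is the information available just before the arm of step \<open>t\<close> is drawn:
  it contains the arms pulled earlier as well as the contexts and reward vectors of the steps up
  to and including \<open>t\<close>.  Contexts and rewards are otherwise arbitrary, so they may be
  deterministic, random, or adapted to the earlier pulls.  Since \<open>F\<close> may be larger than the
  generated filtration, environments with private randomness are covered.
\<close>

locale contextual_bandit = prob_space M + filtration "space M" F
  for M :: "'a measure" and F :: "nat \<Rightarrow> 'a measure" +
  fixes S :: "'c measure"
    and K N T :: nat
    and ctx :: "nat \<Rightarrow> 'a \<Rightarrow> 'c"
    and adv :: "nat \<Rightarrow> nat \<Rightarrow> 'c \<Rightarrow> nat \<Rightarrow> real"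
    and rew :: "nat \<Rightarrow> nat \<Rightarrow> 'a \<Rightarrow> real"
    and arm :: "nat \<Rightarrow> 'a \<Rightarrow> nat"
  assumes subalgebra_F: "\<And>t. subalgebra M (F t)"
    and ctx_measurable: "\<And>t. t < T \<Longrightarrow> ctx t \<in> F t \<rightarrow>\<^sub>M S"
    and adv_measurable:
      "\<And>t i j. t < T \<Longrightarrow> i < N \<Longrightarrow> j < K \<Longrightarrow> (\<lambda>c. adv i t c j) \<in> borel_measurable S"
    and adv_nonneg:
      "\<And>t i c j. t < T \<Longrightarrow> i < N \<Longrightarrow> c \<in> space S \<Longrightarrow> j < K \<Longrightarrow> 0 \<le> adv i t c j"
    and adv_sum:
      "\<And>t i c. t < T \<Longrightarrow> i < N \<Longrightarrow> c \<in> space S \<Longrightarrow> (\<Sum>j<K. adv i t c j) = 1"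
    and rew_measurable: "\<And>t j. t < T \<Longrightarrow> j < K \<Longrightarrow> rew t j \<in> borel_measurable (F t)"
    and arm_measurable: "\<And>t. t < T \<Longrightarrow> arm t \<in> F (Suc t) \<rightarrow>\<^sub>M count_space {..<K}"
begin

definition advice :: "'a \<Rightarrow> nat \<Rightarrow> nat \<Rightarrow> nat \<Rightarrow> real" where
  "advice \<omega> t i j = adv i t (ctx t \<omega>) j"

definition expert_reward :: "nat \<Rightarrow> 'a \<Rightarrow> real" where
  "expert_reward i \<omega> = (\<Sum>t<T. \<Sum>j<K. advice \<omega> t i j * rew t j \<omega>)"

definition player_reward :: "'a \<Rightarrow> real" where
  "player_reward \<omega> = (\<Sum>t<T. rew t (arm t \<omega>) \<omega>)"

definition regret :: "'a \<Rightarrow> real" where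
  "regret \<omega> = Max ((\<lambda>i. expert_reward i \<omega>) ` {..<N}) - player_reward \<omega>"

definition uniform_expert :: "nat \<Rightarrow> bool" where
  "uniform_expert i \<longleftrightarrow>
     i < N \<and> (\<forall>t<T. \<forall>c\<in>space S. \<forall>j<K. adv i t c j = 1 / real K)"

definition arm_prob :: "real \<Rightarrow> real \<Rightarrow> nat \<Rightarrow> nat \<Rightarrow> 'a \<Rightarrow> real" where
  "arm_prob \<alpha> \<gamma> t j \<omega> =
     exp4p_prob K N \<gamma> (advice \<omega> t)
       (exp4p_weight K N T \<alpha> \<gamma> (advice \<omega>) (\<lambda>s k. rew s k \<omega>) (\<lambda>s. arm s \<omega>) t) j"

text \<open>The player runs EXP4.P: given \<open>F t\<close>, arm \<open>j\<close> is drawn with probability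
  \<open>arm_prob \<alpha> \<gamma> t j\<close>.\<close>

definition plays_exp4p :: "real \<Rightarrow> real \<Rightarrow> bool" where
  "plays_exp4p \<alpha> \<gamma> \<longleftrightarrow>
     (\<forall>t<T. \<forall>j<K. AE \<omega> in M.
        real_cond_exp M (F t) (indicator {\<omega> \<in> space M. arm t \<omega> = j}) \<omega> = arm_prob \<alpha> \<gamma> t j \<omega>)"

end

end

theory Submission
  imports Defs
begin

text \<open>
  The proof follows the Exp3.P method.  Write \<open>q\<close> for the normalised weights.  The bonus
  \<open>\<alpha> / ((q + \<gamma>/K) * sqrt (N*T))\<close> dominates \<open>\<theta>\<close> times the conditional variance of the gain estimate,
  where \<open>\<theta> = \<alpha> / (2 * sqrt (N*T))\<close>; hence, as long as \<open>\<theta> \<le> 1\<close>, for each expert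
  \<open>exp (\<theta> * (\<Sum>s<t. gain - estimate - bonus))\<close> is a supermartingale, and Markov's inequality with
  a union bound shows that the estimated gains plus bonuses plus \<open>\<alpha> * sqrt (N*T)\<close> are simultaneous
  upper confidence bounds for the true gains.  On that event the growth of the logarithm of the
  total weight compares the largest upper bound with the reward of the player; the uniform expert
  turns the second-order term into \<open>K\<close> times an estimated gain.  If \<open>\<theta> > 1\<close>, the claimed
  bound exceeds \<open>T\<close> and there is nothing to prove.
\<close>

text \<open>Only an upper bound on \<open>x\<close> is available later, since an importance-weighted
  estimate can push the exponent far below zero. For negative \<open>x\<close> the claim is
  multiplied by \<open>exp y\<close> with \<open>y = - x\<close>; putting the quadratic Taylor
  minorant in place of \<open>exp y\<close> leaves a product equal to 1 plus nonnegative
  terms.\<close>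

lemma exp_le_quadratic:
  fixes x :: real
  assumes "x \<le> 1"
  shows "exp x \<le> 1 + x + x\<^sup>2"
proof (cases "0 \<le> x")
  case True
  then show ?thesis
    using assms by (rule exp_bound)
next
  case False
  define y where "y = - x"
  have "0 \<le> y"
    using False by (simp add: y_def)
  have "1 \<le> 1 + (y\<^sup>2 + y^3 + y^4) / 2"
    using \<open>0 \<le> y\<close> by simp
  also have "\<dots> = (1 - y + y\<^sup>2) * (1 + y + y\<^sup>2 / 2)"
    by (simp add: field_simps power2_eq_square power3_eq_cube power4_eq_xxxx)
  also have "\<dots> \<le> (1 - y + y\<^sup>2) * exp y"
  proof (rule mult_left_mono)
    show "1 + y + y\<^sup>2 / 2 \<le> exp y"
      using exp_lower_Taylor_quadratic[OF \<open>0 \<le> y\<close>] .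
    show "0 \<le> 1 - y + y\<^sup>2"
      using sum_squares_ge_zero[of "y - 1/2" 0] by (simp add: power2_eq_square algebra_simps)
  qed
  finally have "exp (- y) \<le> 1 - y + y\<^sup>2"
    by (simp add: exp_minus field_simps)
  then show ?thesis
    by (simp add: y_def)
qed

subsection \<open>Pathwise analysis\<close>

text \<open>Free of assumptions, so that these quantities are total functions of the outcome and
  their measurability can be stated; \<open>exp4p_path\<close> is established only at outcomes in
  \<open>space M\<close>.\<close>

locale exp4p_env =
  fixes K N T :: nat and \<alpha> \<gamma> :: real
    and e :: "nat \<Rightarrow> nat \<Rightarrow> nat \<Rightarrow> real" and x :: "nat \<Rightarrow> nat \<Rightarrow> real" and a :: "nat \<Rightarrow> nat"
begin

definition w :: "nat \<Rightarrow> nat \<Rightarrow> real" where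
  "w t = exp4p_weight K N T \<alpha> \<gamma> e x a t"

definition q :: "nat \<Rightarrow> nat \<Rightarrow> real" where
  "q t i = w t i / (\<Sum>l<N. w t l)"

definition p :: "nat \<Rightarrow> nat \<Rightarrow> real" where
  "p t j = exp4p_prob K N \<gamma> (e t) (w t) j"

definition gain :: "nat \<Rightarrow> nat \<Rightarrow> real" where
  "gain t i = (\<Sum>j<K. e t i j * x t j)"

definition gain_est :: "nat \<Rightarrow> nat \<Rightarrow> real" where
  "gain_est t i = exp4p_gain_est K (e t) (p t) (x t) (a t) i"

definition bonus :: "nat \<Rightarrow> nat \<Rightarrow> real" where
  "bonus t i = \<alpha> / ((q t i + \<gamma> / real K) * sqrt (real N * real T))"

text \<open>By \<open>ln_w\<close> this is \<open>ln (w T i)\<close> divided by the step size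
  \<open>\<gamma> / (3 * real K)\<close>; the leading term comes from the initial weight.\<close>

definition upper_bound :: "nat \<Rightarrow> real" where
  "upper_bound i = \<alpha> * sqrt (real N * real T) + (\<Sum>t<T. gain_est t i + bonus t i)"

lemma w_Suc: "w (Suc t) i = w t i * exp (\<gamma> / (3 * real K) * (gain_est t i + bonus t i))"
  by (simp add: w_def gain_est_def bonus_def q_def p_def[abs_def] Let_def)

end

text \<open>The cap \<open>\<alpha>_le\<close> keeps two exponents at most 1, as
  \<open>exp_le_quadratic\<close> demands: it gives \<theta> \<le> 1 in the moment bound, and
  through \<open>bonus_le\<close> it controls the weight update.\<close>

locale exp4p_path = exp4p_env +
  assumes K_pos: "0 < K" and N_pos: "0 < N" and T_pos: "0 < T"
    and \<gamma>_pos: "0 < \<gamma>" and \<gamma>_le: "\<gamma> \<le> 1 / 2"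
    and \<alpha>_pos: "0 < \<alpha>" and \<alpha>_le: "\<alpha> \<le> 2 * sqrt (real N * real T)"
    and e_nonneg: "\<And>t i j. t < T \<Longrightarrow> i < N \<Longrightarrow> j < K \<Longrightarrow> 0 \<le> e t i j"
    and e_sum: "\<And>t i. t < T \<Longrightarrow> i < N \<Longrightarrow> (\<Sum>j<K. e t i j) = 1"
    and x_nonneg: "\<And>t j. t < T \<Longrightarrow> j < K \<Longrightarrow> 0 \<le> x t j"
    and x_le: "\<And>t j. t < T \<Longrightarrow> j < K \<Longrightarrow> x t j \<le> 1"
    and a_less: "\<And>t. t < T \<Longrightarrow> a t < K"
begin

section \<open>Weights, sampling probabilities and bounds on the estimates\<close>

lemma w_pos: "0 < w t i"
  by (induction t) (simp_all add: w_Suc, simp add: w_def)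

lemma sum_w_pos: "0 < (\<Sum>l<N. w t l)"
  using N_pos by (intro sum_pos w_pos) auto

lemma q_pos: "0 < q t i"
  by (simp add: q_def w_pos sum_w_pos)

lemma q_sum: "(\<Sum>i<N. q t i) = 1"
  using sum_w_pos[of t] by (simp add: q_def sum_divide_distrib[symmetric])

lemma p_eq: "p t j = (1 - \<gamma>) * (\<Sum>i<N. q t i * e t i j) + \<gamma> / real K"
  by (simp add: p_def exp4p_prob_def q_def)

lemma p_sum:
  assumes "t < T"
  shows "(\<Sum>j<K. p t j) = 1"
proof -
  have "(\<Sum>j<K. \<Sum>i<N. q t i * e t i j) = (\<Sum>i<N. q t i * (\<Sum>j<K. e t i j))"
    by (subst sum.swap) (simp add: sum_distrib_left)
  also have "\<dots> = 1"
    using assms by (simp add: e_sum q_sum)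
  finally have "(\<Sum>j<K. \<Sum>i<N. q t i * e t i j) = 1" .
  then show ?thesis
    using K_pos by (simp add: p_eq sum.distrib sum_distrib_left[symmetric])
qed

lemma mixture_nonneg:
  assumes "t < T" "j < K"
  shows "0 \<le> (\<Sum>i<N. q t i * e t i j)"
  using assms by (auto intro!: sum_nonneg mult_nonneg_nonneg e_nonneg simp: less_imp_le[OF q_pos])

lemma p_ge:
  assumes "t < T" "j < K"
  shows "\<gamma> / real K \<le> p t j"
  using mixture_nonneg[OF assms] \<gamma>_le by (simp add: p_eq)

lemma p_pos:
  assumes "t < T" "j < K"
  shows "0 < p t j"
  using p_ge[OF assms] \<gamma>_pos K_pos by (smt (verit) divide_pos_pos of_nat_0_less_iff)

lemma e_le_1:
  assumes "t < T" "i < N" "j < K"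
  shows "e t i j \<le> 1"
  using e_sum[OF assms(1,2)] member_le_sum[of j "{..<K}" "e t i"] e_nonneg assms by auto

lemma q_floor_pos: "0 < q t i + \<gamma> / real K"
  using q_pos \<gamma>_pos by (intro add_pos_nonneg) auto

lemma sqrt_NT_pos: "0 < sqrt (real N * real T)"
  using N_pos T_pos by simp

lemma bonus_pos: "0 < bonus t i"
  unfolding bonus_def using \<alpha>_pos q_floor_pos sqrt_NT_pos by (intro divide_pos_pos mult_pos_pos)

text \<open>The share of expert \<open>i\<close> in the mixture keeps a factor 1 - \<gamma> \<ge>
  1/2, and uniform exploration covers the \<open>\<gamma> / real K\<close> part because advice is at
  most 1. This ties the denominator of the bonus to the inverse probabilities in the
  variance.\<close>

lemma e_le_p:
  assumes "t < T" "i < N" "j < K"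
  shows "e t i j * (q t i + \<gamma> / real K) \<le> 2 * p t j"
proof -
  have "q t i * e t i j \<le> (\<Sum>i<N. q t i * e t i j)"
    using assms by (intro member_le_sum) (auto simp: less_imp_le[OF q_pos] e_nonneg)
  also have "\<dots> \<le> 2 * (1 - \<gamma>) * (\<Sum>i<N. q t i * e t i j)"
    using mult_right_mono[of 1 "2 * (1 - \<gamma>)"] mixture_nonneg[OF assms(1,3)] \<gamma>_le by simp
  finally have 1: "q t i * e t i j \<le> 2 * (1 - \<gamma>) * (\<Sum>i<N. q t i * e t i j)" .
  have 2: "e t i j * (\<gamma> / real K) \<le> \<gamma> / real K"
    using mult_right_mono[OF e_le_1[OF assms], of "\<gamma> / real K"] \<gamma>_pos by simp
  have 3: "0 \<le> \<gamma> / real K"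
    using \<gamma>_pos by simp
  show ?thesis
    using 1 2 3 unfolding p_eq distrib_left by (simp only: mult.assoc mult.commute[of "e t i j"])
qed

lemma gain_est_eq:
  assumes "t < T"
  shows "gain_est t i = e t i (a t) * x t (a t) / p t (a t)"
proof -
  have "gain_est t i = (\<Sum>j<K. if j = a t then e t i j * x t j / p t j else 0)"
    unfolding gain_est_def exp4p_gain_est_def exp4p_reward_est_def
    by (intro sum.cong) auto
  then show ?thesis
    using a_less[OF assms] by simp
qed

lemma gain_est_nonneg:
  assumes "t < T" "i < N"
  shows "0 \<le> gain_est t i"
  using a_less[OF assms(1)] assms
  by (simp add: gain_est_eq e_nonneg x_nonneg p_pos less_imp_le)

lemma gain_est_le:
  assumes "t < T" "i < N"
  shows "gain_est t i \<le> real K / \<gamma>"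
proof -
  have "e t i (a t) * x t (a t) \<le> 1"
    using assms a_less[OF assms(1)] by (simp add: mult_le_one e_le_1 x_nonneg x_le)
  then have "gain_est t i \<le> 1 / p t (a t)"
    using assms p_pos[OF assms(1) a_less[OF assms(1)]]
    by (simp add: gain_est_eq divide_right_mono)
  also have "\<dots> \<le> 1 / (\<gamma> / real K)"
    using p_ge[OF assms(1) a_less[OF assms(1)]] \<gamma>_pos K_pos by (intro frac_le) auto
  finally show ?thesis
    by simp
qed

lemma bonus_le: "bonus t i \<le> 2 * real K / \<gamma>"
proof -
  have "bonus t i \<le> (2 * sqrt (real N * real T)) / ((\<gamma> / real K) * sqrt (real N * real T))"
    unfolding bonus_def using \<alpha>_le \<alpha>_pos q_pos[of t i] \<gamma>_pos K_pos sqrt_NT_pos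
    by (intro frac_le mult_right_mono mult_pos_pos) auto
  also have "\<dots> = 2 * real K / \<gamma>"
    using N_pos T_pos by simp
  finally show ?thesis .
qed

lemma gain_le_1:
  assumes "t < T" "i < N"
  shows "gain t i \<le> 1"
proof -
  have "gain t i \<le> (\<Sum>j<K. e t i j * 1)"
    unfolding gain_def using assms
    by (intro sum_mono mult_left_mono) (auto simp: e_nonneg x_le)
  then show ?thesis
    using assms by (simp add: e_sum)
qed

text \<open>The bonus absorbs the conditional variance of the gain estimate, which is at most
  \<open>2 / (q t i + \<gamma> / K)\<close>.\<close>

lemma exponential_moment:
  assumes "t < T" "i < N" "\<theta> = \<alpha> / (2 * sqrt (real N * real T))"
  shows "(\<Sum>j<K. p t j * exp (\<theta> * (gain t i - e t i j * x t j / p t j - bonus t i))) \<le> 1"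
proof -
  \<comment> \<open>\<open>d j\<close> is the value of the gain estimate when arm \<open>j\<close>
    is drawn, so sums weighted by \<open>p t j\<close> are conditional expectations over the draw;
    \<open>pd\<close> is unbiasedness.\<close>
  define d where "d j = e t i j * x t j / p t j" for j
  have \<theta>: "0 \<le> \<theta>" "\<theta> \<le> 1"
    using \<alpha>_pos \<alpha>_le sqrt_NT_pos by (simp_all add: assms(3))
  have d_nonneg: "0 \<le> d j" if "j < K" for j
    using that assms by (simp add: d_def e_nonneg x_nonneg p_pos less_imp_le)
  have pd: "(\<Sum>j<K. p t j * d j) = gain t i"
    unfolding gain_def d_def using assms p_pos
    by (intro sum.cong) (auto simp: less_imp_neq[OF p_pos, symmetric])
  \<comment> \<open>One factor \<open>e t i j / p t j\<close> is traded for the uniform bound from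
    \<open>e_le_p\<close>; the other factor \<open>e t i j\<close> is kept, so that summing over the
    arms gives 1 rather than \<open>K\<close>.\<close>
  have pd2: "p t j * (d j)\<^sup>2 \<le> e t i j * (2 / (q t i + \<gamma> / real K))" if "j < K" for j
  proof -
    have pj: "0 < p t j"
      using that assms p_pos by blast
    have "p t j * (d j)\<^sup>2 = (e t i j * (x t j)\<^sup>2) * (e t i j / p t j)"
      using pj by (simp add: d_def power2_eq_square)
    also have "\<dots> \<le> (e t i j * 1) * (2 / (q t i + \<gamma> / real K))"
    proof (intro mult_mono)
      show "e t i j / p t j \<le> 2 / (q t i + \<gamma> / real K)"
        using e_le_p[OF assms(1,2) that] pj q_floor_pos[of t i] by (simp add: frac_le_eq field_simps)
      show "(x t j)\<^sup>2 \<le> 1"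
        using that assms by (simp add: power_le_one x_nonneg x_le)
    qed (use that assms pj in \<open>simp_all add: e_nonneg\<close>)
    finally show ?thesis
      by simp
  qed
  have "(\<Sum>j<K. p t j * (gain t i - d j)\<^sup>2)
      = (\<Sum>j<K. (gain t i)\<^sup>2 * p t j - 2 * gain t i * (p t j * d j) + p t j * (d j)\<^sup>2)"
    by (intro sum.cong) (auto simp: power2_eq_square algebra_simps)
  also have "\<dots> = (\<Sum>j<K. p t j * (d j)\<^sup>2) - (gain t i)\<^sup>2"
    by (simp add: sum.distrib sum_subtractf sum_distrib_left[symmetric] pd p_sum[OF assms(1)]
        power2_eq_square)
  also have "\<dots> \<le> (\<Sum>j<K. e t i j * (2 / (q t i + \<gamma> / real K)))"
    using sum_mono[of "{..<K}" "\<lambda>j. p t j * (d j)\<^sup>2"] pd2 by (smt (verit) lessThan_iff zero_le_power2)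
  also have "\<dots> = 2 / (q t i + \<gamma> / real K)"
    unfolding sum_distrib_right[symmetric] e_sum[OF assms(1,2)] by simp
  finally have var: "(\<Sum>j<K. p t j * (gain t i - d j)\<^sup>2) \<le> 2 / (q t i + \<gamma> / real K)" .
  \<comment> \<open>This identity fixes the factor 1/2 in \<theta>: the linear bonus term equals the
    quadratic term evaluated at the variance bound.\<close>
  have \<theta>_bonus: "\<theta> * bonus t i = \<theta>\<^sup>2 * (2 / (q t i + \<gamma> / real K))"
    using sqrt_NT_pos q_floor_pos[of t i] by (simp add: assms(3) bonus_def power2_eq_square field_simps)
  have "(\<Sum>j<K. p t j * exp (\<theta> * (gain t i - d j)))
      \<le> (\<Sum>j<K. p t j * (1 + \<theta> * (gain t i - d j) + (\<theta> * (gain t i - d j))\<^sup>2))"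
  proof (intro sum_mono mult_left_mono exp_le_quadratic)
    fix j assume j: "j \<in> {..<K}"
    \<comment> \<open>The estimate may be huge, but it enters with a negative sign, so the exponent
      stays bounded above.\<close>
    have "gain t i - d j \<le> 1"
      using gain_le_1[OF assms(1,2)] d_nonneg[of j] j by simp
    then have "\<theta> * (gain t i - d j) \<le> \<theta> * 1"
      using \<theta> by (intro mult_left_mono) auto
    then show "\<theta> * (gain t i - d j) \<le> 1"
      using \<theta> by simp
    show "0 \<le> p t j"
      using j p_pos[OF assms(1)] by (simp add: less_imp_le)
  qed
  also have "\<dots> = (\<Sum>j<K. (1 + \<theta> * gain t i) * p t j - \<theta> * (p t j * d j)
      + \<theta>\<^sup>2 * (p t j * (gain t i - d j)\<^sup>2))"
    unfolding power_mult_distrib by (intro sum.cong) (simp_all add: algebra_simps)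
  also have "\<dots> = 1 + \<theta>\<^sup>2 * (\<Sum>j<K. p t j * (gain t i - d j)\<^sup>2)"
    by (simp add: sum.distrib sum_subtractf sum_distrib_left[symmetric] pd p_sum[OF assms(1)])
  also have "\<dots> \<le> 1 + \<theta> * bonus t i"
    unfolding \<theta>_bonus using var by (intro add_left_mono mult_left_mono) auto
  also have "\<dots> \<le> exp (\<theta> * bonus t i)"
    by (rule exp_ge_add_one_self)
  finally have le: "(\<Sum>j<K. p t j * exp (\<theta> * (gain t i - d j))) \<le> exp (\<theta> * bonus t i)" .
  have "(\<Sum>j<K. p t j * exp (\<theta> * (gain t i - d j - bonus t i)))
      = (\<Sum>j<K. p t j * exp (\<theta> * (gain t i - d j))) / exp (\<theta> * bonus t i)"
    by (simp add: sum_divide_distrib right_diff_distrib exp_diff)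
  also have "\<dots> \<le> 1"
    using le by simp
  finally show ?thesis
    by (simp add: d_def)
qed

section \<open>Averages of estimates and bonuses under the normalised weights\<close>

text \<open>The mixture at the pulled arm, times 1 - \<gamma>, is at most the sampling probability,
  which cancels one inverse probability. None is left in the first moment and one in the second,
  where rewards and advice in [0,1] allow their squares to be replaced by first powers.\<close>

lemma weighted_gain_est:
  assumes "t < T"
  shows "(1 - \<gamma>) * (\<Sum>i<N. q t i * gain_est t i) \<le> x t (a t)"
    and "(1 - \<gamma>) * (\<Sum>i<N. q t i * (gain_est t i)\<^sup>2) \<le> x t (a t) / p t (a t)"
proof -
  define m where "m = (\<Sum>i<N. q t i * e t i (a t))"
  have a: "a t < K"
    using assms by (rule a_less)
  have pos: "0 < p t (a t)" and x: "0 \<le> x t (a t)" "x t (a t) \<le> 1"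
    using assms a p_pos x_nonneg x_le by auto
  have m: "(1 - \<gamma>) * m \<le> p t (a t)"
    using \<gamma>_pos by (simp add: m_def p_eq)
  have "(\<Sum>i<N. q t i * gain_est t i) = m * (x t (a t) / p t (a t))"
    using assms by (simp add: m_def gain_est_eq sum_distrib_right sum_divide_distrib mult.assoc)
  then have "(1 - \<gamma>) * (\<Sum>i<N. q t i * gain_est t i) = ((1 - \<gamma>) * m) * (x t (a t) / p t (a t))"
    by simp
  also have "\<dots> \<le> p t (a t) * (x t (a t) / p t (a t))"
    using m pos x by (intro mult_right_mono) auto
  finally show "(1 - \<gamma>) * (\<Sum>i<N. q t i * gain_est t i) \<le> x t (a t)"
    using pos by simp
  have "(\<Sum>i<N. q t i * (gain_est t i)\<^sup>2) \<le> (\<Sum>i<N. (q t i * e t i (a t)) * (x t (a t) / (p t (a t))\<^sup>2))"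
  proof (rule sum_mono)
    fix i assume i: "i \<in> {..<N}"
    have e: "0 \<le> e t i (a t)" "e t i (a t) \<le> 1"
      using i assms a e_nonneg e_le_1 by auto
    have "(e t i (a t))\<^sup>2 * (x t (a t))\<^sup>2 \<le> e t i (a t) * x t (a t)"
      using e x by (intro mult_mono) (auto simp: power2_eq_square mult_left_le)
    then have "(e t i (a t))\<^sup>2 * (x t (a t))\<^sup>2 / (p t (a t))\<^sup>2 \<le> e t i (a t) * x t (a t) / (p t (a t))\<^sup>2"
      by (intro divide_right_mono) auto
    then have "q t i * ((e t i (a t))\<^sup>2 * (x t (a t))\<^sup>2 / (p t (a t))\<^sup>2)
        \<le> q t i * (e t i (a t) * x t (a t) / (p t (a t))\<^sup>2)"
      using q_pos[of t i] by (intro mult_left_mono) auto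
    then show "q t i * (gain_est t i)\<^sup>2 \<le> (q t i * e t i (a t)) * (x t (a t) / (p t (a t))\<^sup>2)"
      using assms by (simp add: gain_est_eq power_divide power_mult_distrib mult.assoc)
  qed
  also have "\<dots> = m * (x t (a t) / (p t (a t))\<^sup>2)"
    by (simp only: m_def sum_distrib_right)
  finally have "(1 - \<gamma>) * (\<Sum>i<N. q t i * (gain_est t i)\<^sup>2)
      \<le> (1 - \<gamma>) * (m * (x t (a t) / (p t (a t))\<^sup>2))"
    using \<gamma>_le by (intro mult_left_mono) auto
  also have "\<dots> = ((1 - \<gamma>) * m) * (x t (a t) / (p t (a t))\<^sup>2)"
    by simp
  also have "\<dots> \<le> p t (a t) * (x t (a t) / (p t (a t))\<^sup>2)"
    using m x by (intro mult_right_mono) auto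
  finally show "(1 - \<gamma>) * (\<Sum>i<N. q t i * (gain_est t i)\<^sup>2) \<le> x t (a t) / p t (a t)"
    using pos by (simp add: power2_eq_square)
qed

text \<open>Since \<open>q / (q + \<gamma> / K)\<close> is at most 1, each weighted bonus costs at
  most \<open>\<alpha> / s\<close> with \<open>s = sqrt (N * T)\<close>, and
  \<open>N / s = s / T\<close>. For squares, the second bonus factor is bounded using the floor
  \<open>\<gamma> / K\<close> alone.\<close>

lemma weighted_bonus:
  shows "(\<Sum>i<N. q t i * bonus t i) \<le> \<alpha> * sqrt (real N * real T) / real T"
    and "(\<Sum>i<N. q t i * (bonus t i)\<^sup>2) \<le> \<alpha>\<^sup>2 * real K / (\<gamma> * real T)"
proof -
  define s where "s = sqrt (real N * real T)"
  have s: "0 < s" "s\<^sup>2 = real N * real T"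
    using sqrt_NT_pos by (simp_all add: s_def)
  have qb: "q t i * bonus t i \<le> \<alpha> / s" for i
  proof -
    have "q t i * bonus t i = (q t i / (q t i + \<gamma> / real K)) * (\<alpha> / s)"
      by (simp add: bonus_def s_def)
    also have "\<dots> \<le> 1 * (\<alpha> / s)"
      using q_floor_pos[of t i] \<gamma>_pos \<alpha>_pos s by (intro mult_right_mono) auto
    finally show ?thesis
      by simp
  qed
  have b: "bonus t i \<le> (\<alpha> / s) * (real K / \<gamma>)" for i
  proof -
    have "bonus t i \<le> \<alpha> / ((\<gamma> / real K) * s)"
      unfolding bonus_def s_def[symmetric] using \<alpha>_pos q_pos[of t i] \<gamma>_pos K_pos s
      by (intro divide_left_mono mult_right_mono mult_pos_pos q_floor_pos) auto
    then show ?thesis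
      by (simp add: mult.commute)
  qed
  have "(\<Sum>i<N. q t i * bonus t i) \<le> real N * (\<alpha> / s)"
    using sum_bounded_above[of "{..<N}" "\<lambda>i. q t i * bonus t i" "\<alpha> / s"] qb by simp
  also have "\<dots> = \<alpha> * s / real T"
    using s T_pos by (simp add: field_simps power2_eq_square)
  finally show "(\<Sum>i<N. q t i * bonus t i) \<le> \<alpha> * sqrt (real N * real T) / real T"
    by (simp add: s_def)
  have "q t i * (bonus t i)\<^sup>2 \<le> \<alpha>\<^sup>2 * real K / (\<gamma> * (real N * real T))" for i
  proof -
    have "q t i * (bonus t i)\<^sup>2 = (q t i * bonus t i) * bonus t i"
      by (simp add: power2_eq_square)
    also have "\<dots> \<le> (\<alpha> / s) * ((\<alpha> / s) * (real K / \<gamma>))"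
      using qb[of i] b[of i] bonus_pos[of t i] \<alpha>_pos s by (intro mult_mono) auto
    also have "\<dots> = \<alpha>\<^sup>2 * real K / (\<gamma> * s\<^sup>2)"
      by (simp add: power2_eq_square mult_ac)
    finally show ?thesis
      by (simp add: s)
  qed
  then have "(\<Sum>i<N. q t i * (bonus t i)\<^sup>2) \<le> real N * (\<alpha>\<^sup>2 * real K / (\<gamma> * (real N * real T)))"
    using sum_bounded_above[of "{..<N}" "\<lambda>i. q t i * (bonus t i)\<^sup>2"]
    unfolding card_lessThan by blast
  also have "\<dots> = \<alpha>\<^sup>2 * real K / (\<gamma> * real T)"
    using N_pos by simp
  finally show "(\<Sum>i<N. q t i * (bonus t i)\<^sup>2) \<le> \<alpha>\<^sup>2 * real K / (\<gamma> * real T)" .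
qed

section \<open>Growth of the total weight and the pathwise regret bound\<close>

lemma ln_w: "ln (w t i)
  = \<gamma> / (3 * real K) * (\<alpha> * sqrt (real N * real T) + (\<Sum>s<t. gain_est s i + bonus s i))"
proof (induction t)
  case 0
  show ?case by (simp add: w_def)
next
  case (Suc t)
  have "ln (w (Suc t) i) = ln (w t i) + \<gamma> / (3 * real K) * (gain_est t i + bonus t i)"
    using w_pos[of t i] by (simp add: w_Suc ln_mult)
  then show ?case
    by (simp add: Suc algebra_simps)
qed

text \<open>The ratio of successive total weights is the \<open>q\<close>-average of the update
  factors. Expanding each factor to second order, inserting the averaged bounds and using
  \<open>ln z \<le> z - 1\<close> gives the growth of one step.\<close>

lemma ln_sum_w_Suc_le:
  assumes t: "t < T"
  defines "\<eta> \<equiv> \<gamma> / (3 * real K)"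
  shows "ln (\<Sum>i<N. w (Suc t) i) - ln (\<Sum>i<N. w t i)
    \<le> \<eta> * (x t (a t) / (1 - \<gamma>) + \<alpha> * sqrt (real N * real T) / real T
        + 2 * \<eta> * (x t (a t) / p t (a t)) / (1 - \<gamma>)
        + 2 * \<alpha>\<^sup>2 / (3 * real T))"
proof -
  define W where "W t = (\<Sum>i<N. w t i)" for t
  have W: "0 < W t" for t
    by (simp add: W_def sum_w_pos)
  have \<eta>: "0 < \<eta>"
    using \<gamma>_pos K_pos by (simp add: \<eta>_def)
  have factor: "exp (\<eta> * (gain_est t i + bonus t i))
      \<le> 1 + \<eta> * (gain_est t i + bonus t i) + 2 * \<eta>\<^sup>2 * ((gain_est t i)\<^sup>2 + (bonus t i)\<^sup>2)"
    if i: "i < N" for i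
  proof -
    \<comment> \<open>The step size \<eta> is exactly the reciprocal of this bound:
      \<open>K / \<gamma>\<close> from the estimate and \<open>2 * K / \<gamma>\<close> from the
      bonus.\<close>
    have "gain_est t i + bonus t i \<le> 3 * real K / \<gamma>"
      using gain_est_le[OF t i] bonus_le[of t i] by (simp add: add_divide_distrib[symmetric])
    then have "\<eta> * (gain_est t i + bonus t i) \<le> \<eta> * (3 * real K / \<gamma>)"
      using \<eta> by (intro mult_left_mono) auto
    also have "\<dots> = 1"
      using \<gamma>_pos K_pos by (simp add: \<eta>_def)
    finally have "exp (\<eta> * (gain_est t i + bonus t i))
        \<le> 1 + \<eta> * (gain_est t i + bonus t i) + \<eta>\<^sup>2 * (gain_est t i + bonus t i)\<^sup>2"
      using exp_le_quadratic[of "\<eta> * (gain_est t i + bonus t i)"] by (simp add: power_mult_distrib)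
    also have "\<eta>\<^sup>2 * (gain_est t i + bonus t i)\<^sup>2 \<le> \<eta>\<^sup>2 * (2 * ((gain_est t i)\<^sup>2 + (bonus t i)\<^sup>2))"
      using zero_le_power2[of "gain_est t i - bonus t i"]
      by (intro mult_left_mono) (simp_all add: power2_eq_square algebra_simps)
    finally show ?thesis
      unfolding mult.assoc[symmetric] mult.commute[of "\<eta>\<^sup>2" 2] by simp
  qed
  have "W (Suc t) / W t = (\<Sum>i<N. q t i * exp (\<eta> * (gain_est t i + bonus t i)))"
    by (simp add: W_def q_def w_Suc sum_divide_distrib \<eta>_def)
  also have "\<dots> \<le> (\<Sum>i<N. q t i * (1 + \<eta> * (gain_est t i + bonus t i)
      + 2 * \<eta>\<^sup>2 * ((gain_est t i)\<^sup>2 + (bonus t i)\<^sup>2)))"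
    using factor q_pos by (intro sum_mono mult_left_mono) (auto simp: less_imp_le)
  also have "\<dots> = 1 + \<eta> * ((\<Sum>i<N. q t i * gain_est t i) + (\<Sum>i<N. q t i * bonus t i)
      + 2 * \<eta> * (\<Sum>i<N. q t i * (gain_est t i)\<^sup>2) + 2 * \<eta> * (\<Sum>i<N. q t i * (bonus t i)\<^sup>2))"
    by (simp add: sum.distrib sum_distrib_left distrib_left power2_eq_square mult_ac q_sum)
  also have "\<dots> \<le> 1 + \<eta> * (x t (a t) / (1 - \<gamma>) + \<alpha> * sqrt (real N * real T) / real T
      + 2 * \<eta> * (x t (a t) / p t (a t) / (1 - \<gamma>)) + 2 * \<eta> * (\<alpha>\<^sup>2 * real K / (\<gamma> * real T)))"
  proof -
    have g: "0 < 1 - \<gamma>"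
      using \<gamma>_le by simp
    have "(\<Sum>i<N. q t i * gain_est t i) \<le> x t (a t) / (1 - \<gamma>)"
        "(\<Sum>i<N. q t i * (gain_est t i)\<^sup>2) \<le> x t (a t) / p t (a t) / (1 - \<gamma>)"
      using weighted_gain_est[OF t] by (simp_all only: pos_le_divide_eq[OF g] mult.commute)
    then show ?thesis
      using \<eta> weighted_bonus[of t] by (intro add_left_mono mult_left_mono add_mono) auto
  qed
  \<comment> \<open>The step size cancels \<open>K / \<gamma>\<close>; summed over the
    \<open>T\<close> steps this leaves 2/3 times \<alpha> squared.\<close>
  also have "2 * \<eta> * (\<alpha>\<^sup>2 * real K / (\<gamma> * real T)) = 2 * \<alpha>\<^sup>2 / (3 * real T)"
    using \<gamma>_pos K_pos T_pos by (simp add: \<eta>_def)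
  finally have le: "W (Suc t) / W t \<le> 1 + \<eta> * (x t (a t) / (1 - \<gamma>)
      + \<alpha> * sqrt (real N * real T) / real T
      + 2 * \<eta> * (x t (a t) / p t (a t)) / (1 - \<gamma>) + 2 * \<alpha>\<^sup>2 / (3 * real T))"
    by simp
  have "ln (W (Suc t)) - ln (W t) = ln (W (Suc t) / W t)"
    using W[of t] W[of "Suc t"] by (simp add: ln_div)
  also have "\<dots> \<le> W (Suc t) / W t - 1"
    using W by (intro ln_le_minus_one) simp
  also note le
  finally show ?thesis
    by (simp add: W_def)
qed

text \<open>The logarithm of the total weight is telescoped over all steps. Its final value is at
  least that of the expert with the largest upper bound, and its growth is paid for by the rewards
  collected plus a second-order term, which the uniform expert relates back to
  \<open>U\<close>.\<close>

lemma player_reward_ge: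
  assumes u: "u < N" "\<And>t j. t < T \<Longrightarrow> j < K \<Longrightarrow> e t u j = 1 / real K"
    and U: "\<And>i. i < N \<Longrightarrow> upper_bound i \<le> U" and k: "k < N" "upper_bound k = U"
  shows "(1 - 5 / 3 * \<gamma>) * U - 3 * real K * ln (real N) / \<gamma>
      - 2 * \<alpha> * sqrt (real N * real T) - 2 / 3 * \<alpha>\<^sup>2 \<le> (\<Sum>t<T. x t (a t))"
proof -
  define \<eta> where "\<eta> = \<gamma> / (3 * real K)"
  define s where "s = sqrt (real N * real T)"
  define Y where "Y = (\<Sum>t<T. x t (a t))"
  define X where "X = (\<Sum>t<T. x t (a t) / p t (a t))"
  define W where "W t = (\<Sum>i<N. w t i)" for t
  have \<eta>: "0 < \<eta>"
    using \<gamma>_pos K_pos by (simp add: \<eta>_def)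
  have s: "0 < s"
    using sqrt_NT_pos by (simp add: s_def)
  have g: "0 < 1 - \<gamma>"
    using \<gamma>_le by simp
  \<comment> \<open>With advice \<open>1 / K\<close>, the estimate of the uniform expert is the
    inverse-probability-weighted reward divided by \<open>K\<close>.\<close>
  have "X = real K * (\<Sum>t<T. gain_est t u)"
    unfolding X_def sum_distrib_left using u K_pos
    by (intro sum.cong) (auto simp: gain_est_eq a_less)
  also have "(\<Sum>t<T. gain_est t u) \<le> upper_bound u"
    unfolding upper_bound_def sum.distrib
    using \<alpha>_pos sum_nonneg[of "{..<T}" "\<lambda>t. bonus t u"] by (simp add: less_imp_le[OF bonus_pos])
  also have "\<dots> \<le> U"
    using u by (intro U)
  finally have X: "X \<le> real K * U"
    by (simp add: mult_left_mono)
  \<comment> \<open>All initial weights agree. Their term \<open>\<alpha> * s\<close> and the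
    equally large total of the averaged bonuses together produce
    \<open>2 * \<alpha> * s\<close>.\<close>
  have W0: "ln (W 0) = ln (real N) + \<eta> * (\<alpha> * s)"
    using N_pos by (simp add: W_def w_def ln_mult \<eta>_def s_def)
  have "\<eta> * U = ln (w T k)"
    using k by (simp add: ln_w upper_bound_def \<eta>_def)
  also have "\<dots> \<le> ln (W T)"
    using w_pos k by (auto simp: W_def sum_w_pos less_imp_le intro!: ln_mono member_le_sum)
  also have "ln (W T) = ln (W 0) + (\<Sum>t<T. ln (W (Suc t)) - ln (W t))"
    by (subst sum_lessThan_telescope) simp
  also have "(\<Sum>t<T. ln (W (Suc t)) - ln (W t))
      \<le> (\<Sum>t<T. \<eta> * (x t (a t) / (1 - \<gamma>) + \<alpha> * s / real T
        + 2 * \<eta> * (x t (a t) / p t (a t)) / (1 - \<gamma>) + 2 * \<alpha>\<^sup>2 / (3 * real T)))"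
    unfolding W_def \<eta>_def s_def by (intro sum_mono ln_sum_w_Suc_le) auto
  also have "\<dots> = \<eta> * (Y / (1 - \<gamma>) + \<alpha> * s + 2 * \<eta> * X / (1 - \<gamma>) + 2 / 3 * \<alpha>\<^sup>2)"
  proof -
    have "(\<Sum>t<T. \<alpha> * s / real T) = \<alpha> * s" "(\<Sum>t<T. 2 * \<alpha>\<^sup>2 / (3 * real T)) = 2 / 3 * \<alpha>\<^sup>2"
      using T_pos by simp_all
    then show ?thesis
      unfolding X_def Y_def sum_divide_distrib sum_distrib_left[symmetric] sum.distrib
      by (simp only: sum_distrib_left sum_divide_distrib)
  qed
  finally have "\<eta> * U \<le> ln (real N) + \<eta> * (\<alpha> * s)
      + \<eta> * (Y / (1 - \<gamma>) + \<alpha> * s + 2 * \<eta> * X / (1 - \<gamma>) + 2 / 3 * \<alpha>\<^sup>2)"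
    by (simp add: W0)
  also have "\<dots> = \<eta> * (ln (real N) / \<eta> + 2 * \<alpha> * s + Y / (1 - \<gamma>) + 2 * \<eta> * X / (1 - \<gamma>)
      + 2 / 3 * \<alpha>\<^sup>2)"
    using \<eta> by (simp add: distrib_left)
  finally have "U \<le> ln (real N) / \<eta> + 2 * \<alpha> * s + Y / (1 - \<gamma>) + 2 * \<eta> * X / (1 - \<gamma>)
      + 2 / 3 * \<alpha>\<^sup>2"
    using \<eta> by simp
  then have "(1 - \<gamma>) * U \<le> (1 - \<gamma>) * (ln (real N) / \<eta> + 2 * \<alpha> * s + Y / (1 - \<gamma>)
      + 2 * \<eta> * X / (1 - \<gamma>) + 2 / 3 * \<alpha>\<^sup>2)"
    using g by (intro mult_left_mono) auto
  also have "\<dots> = (1 - \<gamma>) * (ln (real N) / \<eta> + 2 * \<alpha> * s + 2 / 3 * \<alpha>\<^sup>2) + Y + 2 * \<eta> * X"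
    using g by (simp add: distrib_left)
  \<comment> \<open>The damping 1 - \<gamma> is kept on \<open>U\<close> and relaxed to 1 on the
    costs. The second-order term becomes 2/3 \<gamma> \<open>U\<close>, so the total coefficient
    lost on \<open>U\<close> is 5/3 \<gamma>.\<close>
  also have "\<dots> \<le> 1 * (ln (real N) / \<eta> + 2 * \<alpha> * s + 2 / 3 * \<alpha>\<^sup>2) + Y + 2 * \<eta> * (real K * U)"
    using \<gamma>_pos \<eta> s \<alpha>_pos N_pos X
    by (intro add_mono mult_right_mono mult_left_mono add_nonneg_nonneg) auto
  also have "2 * \<eta> * (real K * U) = 2 / 3 * \<gamma> * U"
    using K_pos by (simp add: \<eta>_def)
  also have "ln (real N) / \<eta> = 3 * real K * ln (real N) / \<gamma>"
    by (simp add: \<eta>_def)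
  finally show ?thesis
    by (simp add: Y_def s_def algebra_simps)
qed

text \<open>For \<gamma> \<le> 1/2 the factor 1 - 5/3 \<gamma> is positive, so the maximal upper
  bound may be replaced by the true gain \<open>G\<close>, which it dominates; the lost multiple of
  \<open>G\<close> is then charged via \<open>G \<le> T\<close>.\<close>

lemma regret_le:
  assumes u: "u < N" "\<And>t j. t < T \<Longrightarrow> j < K \<Longrightarrow> e t u j = 1 / real K"
    and conf: "\<And>i. i < N \<Longrightarrow> (\<Sum>t<T. gain t i) \<le> upper_bound i"
    and k: "k < N"
  shows "(\<Sum>t<T. gain t k) - (\<Sum>t<T. x t (a t))
    \<le> 5 / 3 * \<gamma> * real T + 3 * real K * ln (real N) / \<gamma>
      + 2 * \<alpha> * sqrt (real N * real T) + 2 / 3 * \<alpha>\<^sup>2"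
proof -
  define U where "U = Max (upper_bound ` {..<N})"
  define G where "G = (\<Sum>t<T. gain t k)"
  have ne: "upper_bound ` {..<N} \<noteq> {}"
    using N_pos by auto
  have U: "upper_bound i \<le> U" if "i < N" for i
    using that by (simp add: U_def)
  obtain m where m: "m < N" "upper_bound m = U"
    using Max_in[OF _ ne] unfolding U_def by auto
  have "G \<le> U"
    using conf[OF k] U[OF k] by (simp add: G_def)
  then have "(1 - 5 / 3 * \<gamma>) * G \<le> (1 - 5 / 3 * \<gamma>) * U"
    using \<gamma>_le by (intro mult_left_mono) auto
  moreover have "G \<le> real T"
    using sum_bounded_above[of "{..<T}" "\<lambda>t. gain t k" 1] gain_le_1[OF _ k] by (simp add: G_def)
  then have "5 / 3 * \<gamma> * G \<le> 5 / 3 * \<gamma> * real T"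
    using \<gamma>_pos by (intro mult_left_mono) auto
  ultimately show ?thesis
    using player_reward_ge[OF u U m] by (simp add: G_def algebra_simps)
qed

end

subsection \<open>Concentration of the gain estimates\<close>

context contextual_bandit
begin

lemma arm_less:
  assumes "t < T" "\<omega> \<in> space M"
  shows "arm t \<omega> < K"
  using measurable_space[OF arm_measurable[OF assms(1)], of \<omega>] assms(2) by (simp add: space_F)

lemma ctx_in_space:
  assumes "t < T" "\<omega> \<in> space M"
  shows "ctx t \<omega> \<in> space S"
  using measurable_space[OF ctx_measurable[OF assms(1)], of \<omega>] assms(2) by (simp add: space_F)

text \<open>Serves the case where \<alpha> exceeds \<open>2 * sqrt (N * T)\<close>. An expert earns
  a convex combination of rewards in [0,1] at every step, and the player never earns a negative
  total.\<close>

lemma regret_le_horizon: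
  assumes "0 < N" and \<omega>: "\<omega> \<in> space M"
    and rewards: "\<And>t j. t < T \<Longrightarrow> j < K \<Longrightarrow> 0 \<le> rew t j \<omega> \<and> rew t j \<omega> \<le> 1"
  shows "regret \<omega> \<le> real T"
proof -
  have "(\<Sum>j<K. advice \<omega> t i j * rew t j \<omega>) \<le> 1" if "t < T" "i < N" for t i
  proof -
    have "(\<Sum>j<K. advice \<omega> t i j * rew t j \<omega>) \<le> (\<Sum>j<K. advice \<omega> t i j * 1)"
      using that ctx_in_space[OF _ \<omega>] rewards
      by (intro sum_mono mult_left_mono) (auto simp: advice_def adv_nonneg)
    then show ?thesis
      using that ctx_in_space[OF _ \<omega>] by (simp add: advice_def adv_sum)
  qed
  then have "expert_reward i \<omega> \<le> real T" if "i < N" for i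
    using sum_bounded_above[of "{..<T}" "\<lambda>t. \<Sum>j<K. advice \<omega> t i j * rew t j \<omega>" 1] that
    by (simp add: expert_reward_def)
  then have "Max ((\<lambda>i. expert_reward i \<omega>) ` {..<N}) \<le> real T"
    using \<open>0 < N\<close> by (subst Max_le_iff) auto
  moreover have "0 \<le> player_reward \<omega>"
    unfolding player_reward_def using rewards arm_less[OF _ \<omega>] by (intro sum_nonneg) auto
  ultimately show ?thesis
    by (simp add: regret_def)
qed

end

locale exp4p_run = contextual_bandit +
  fixes \<alpha> \<gamma> :: real
  assumes arms: "0 < K" and experts: "0 < N" and horizon: "0 < T"
    and rew_bounds: "\<And>t j \<omega>. t < T \<Longrightarrow> j < K \<Longrightarrow> \<omega> \<in> space M \<Longrightarrow> 0 \<le> rew t j \<omega> \<and> rew t j \<omega> \<le> 1"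
    and exploration: "0 < \<gamma>" "\<gamma> \<le> 1 / 2"
    and confidence: "0 < \<alpha>" "\<alpha> \<le> 2 * sqrt (real N * real T)"
    and plays: "plays_exp4p \<alpha> \<gamma>"
begin

lemma path:
  assumes "\<omega> \<in> space M"
  shows "exp4p_path K N T \<alpha> \<gamma> (advice \<omega>) (\<lambda>s k. rew s k \<omega>) (\<lambda>s. arm s \<omega>)"
  using assms arms experts horizon exploration confidence rew_bounds arm_less ctx_in_space
  by unfold_locales (auto simp: advice_def adv_nonneg adv_sum)

abbreviation "weight \<omega> \<equiv> exp4p_env.w K N T \<alpha> \<gamma> (advice \<omega>) (\<lambda>s k. rew s k \<omega>) (\<lambda>s. arm s \<omega>)"
abbreviation "prob_at \<omega> \<equiv> exp4p_env.p K N T \<alpha> \<gamma> (advice \<omega>) (\<lambda>s k. rew s k \<omega>) (\<lambda>s. arm s \<omega>)"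
abbreviation "gain_at \<omega> \<equiv> exp4p_env.gain K (advice \<omega>) (\<lambda>s k. rew s k \<omega>)"
abbreviation "est_at \<omega> \<equiv> exp4p_env.gain_est K N T \<alpha> \<gamma> (advice \<omega>) (\<lambda>s k. rew s k \<omega>) (\<lambda>s. arm s \<omega>)"
abbreviation "bonus_at \<omega> \<equiv> exp4p_env.bonus K N T \<alpha> \<gamma> (advice \<omega>) (\<lambda>s k. rew s k \<omega>) (\<lambda>s. arm s \<omega>)"

section \<open>Measurability along the filtration\<close>

lemma borel_measurable_F_mono:
  fixes f :: "'a \<Rightarrow> real"
  assumes "f \<in> borel_measurable (F s)" "s \<le> t"
  shows "f \<in> borel_measurable (F t)"
  using assms sets_F_mono[OF assms(2)] by (auto simp: measurable_def space_F)

lemma borel_measurable_F_M: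
  fixes f :: "'a \<Rightarrow> real"
  assumes "f \<in> borel_measurable (F s)"
  shows "f \<in> borel_measurable M"
  using measurable_from_subalg[OF subalgebra_F assms] .

lemma advice_measurable:
  assumes "t < T" "i < N" "j < K"
  shows "(\<lambda>\<omega>. advice \<omega> t i j) \<in> borel_measurable (F t)"
  unfolding advice_def using measurable_compose[OF ctx_measurable adv_measurable] assms by simp

text \<open>Weights at \<open>Suc t\<close> depend on probabilities, estimates and bonuses at
  \<open>t\<close>, which depend on weights at \<open>t\<close>. Stating this and the next two
  lemmas relative to the weights lets the induction in \<open>weight_measurable\<close> close the
  loop.\<close>

lemma prob_at_measurable_if_weight:
  assumes "t < T" "j < K" and [measurable]: "\<And>i. i < N \<Longrightarrow> (\<lambda>\<omega>. weight \<omega> t i) \<in> borel_measurable (F t)"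
  shows "(\<lambda>\<omega>. prob_at \<omega> t j) \<in> borel_measurable (F t)"
proof -
  note [measurable] = advice_measurable[OF assms(1) _ assms(2)]
  show ?thesis
    unfolding exp4p_env.p_def exp4p_prob_def
    by (intro borel_measurable_add borel_measurable_times borel_measurable_sum
        borel_measurable_divide borel_measurable_const) measurable
qed

lemma bonus_at_measurable_if_weight:
  assumes "i < N" and [measurable]: "\<And>i. i < N \<Longrightarrow> (\<lambda>\<omega>. weight \<omega> t i) \<in> borel_measurable (F t)"
  shows "(\<lambda>\<omega>. bonus_at \<omega> t i) \<in> borel_measurable (F t)"
proof -
  note [measurable] = assms(2)[OF assms(1)]
  have [measurable]: "(\<lambda>\<omega>. \<Sum>l<N. weight \<omega> t l) \<in> borel_measurable (F t)"
    by (intro borel_measurable_sum) auto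
  show ?thesis
    unfolding exp4p_env.bonus_def exp4p_env.q_def by measurable
qed

text \<open>The arm drawn at step \<open>t\<close> enters through the indicator, so the estimate is
  known one step later than the probabilities and the bonus.\<close>

lemma est_at_measurable_if_weight:
  assumes "t < T" "i < N" and w: "\<And>i. i < N \<Longrightarrow> (\<lambda>\<omega>. weight \<omega> t i) \<in> borel_measurable (F t)"
  shows "(\<lambda>\<omega>. est_at \<omega> t i) \<in> borel_measurable (F (Suc t))"
  unfolding exp4p_env.gain_est_def exp4p_gain_est_def exp4p_reward_est_def
proof (intro borel_measurable_sum borel_measurable_times borel_measurable_divide)
  fix j assume "j \<in> {..<K}"
  then have j: "j < K"
    by simp
  show "(\<lambda>\<omega>. advice \<omega> t i j) \<in> borel_measurable (F (Suc t))"
    using borel_measurable_F_mono[OF advice_measurable] assms j by simp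
  show "rew t j \<in> borel_measurable (F (Suc t))"
    using borel_measurable_F_mono[OF rew_measurable] assms j by simp
  show "(\<lambda>\<omega>. prob_at \<omega> t j) \<in> borel_measurable (F (Suc t))"
    using borel_measurable_F_mono[OF prob_at_measurable_if_weight] assms j by simp
  show "(\<lambda>\<omega>. indicator {arm t \<omega>} j) \<in> borel_measurable (F (Suc t))"
    using measurable_compose[OF arm_measurable, of t "\<lambda>b. indicator {b} j" borel] assms by simp
qed

lemma weight_measurable:
  assumes "t \<le> T" "i < N"
  shows "(\<lambda>\<omega>. weight \<omega> t i) \<in> borel_measurable (F t)"
  using assms
proof (induction t arbitrary: i)
  case 0
  then show ?case
    by (simp add: exp4p_env.w_def)
next
  case (Suc t)
  then have "t < T" and w: "(\<lambda>\<omega>. weight \<omega> t i) \<in> borel_measurable (F t)" if "i < N" for i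
    using that by auto
  then have [measurable]: "(\<lambda>\<omega>. weight \<omega> t i) \<in> borel_measurable (F (Suc t))"
      "(\<lambda>\<omega>. bonus_at \<omega> t i) \<in> borel_measurable (F (Suc t))"
      "(\<lambda>\<omega>. est_at \<omega> t i) \<in> borel_measurable (F (Suc t))"
    using Suc.prems borel_measurable_F_mono[OF bonus_at_measurable_if_weight]
      borel_measurable_F_mono[OF w] est_at_measurable_if_weight by auto
  show ?case
    unfolding exp4p_env.w_Suc by measurable
qed

lemma prob_at_measurable:
  assumes "t < T" "j < K"
  shows "(\<lambda>\<omega>. prob_at \<omega> t j) \<in> borel_measurable (F t)"
  using assms by (intro prob_at_measurable_if_weight weight_measurable) auto

lemma bonus_at_measurable:
  assumes "t < T" "i < N"
  shows "(\<lambda>\<omega>. bonus_at \<omega> t i) \<in> borel_measurable (F t)"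
  using assms by (intro bonus_at_measurable_if_weight weight_measurable) auto

lemma est_at_measurable:
  assumes "t < T" "i < N"
  shows "(\<lambda>\<omega>. est_at \<omega> t i) \<in> borel_measurable (F (Suc t))"
  using assms by (intro est_at_measurable_if_weight weight_measurable) auto

lemma gain_at_measurable:
  assumes "t < T" "i < N"
  shows "(\<lambda>\<omega>. gain_at \<omega> t i) \<in> borel_measurable (F t)"
  unfolding exp4p_env.gain_def
  using assms by (intro borel_measurable_sum borel_measurable_times advice_measurable rew_measurable) auto

section \<open>Averaging over the drawn arm\<close>

text \<open>Integrated form of conditioning on \<open>F t\<close>: the integrand is split by the
  value of the drawn arm, each \<open>f j\<close> is known at \<open>F t\<close> and can be moved
  past the conditional expectation of the indicator, and \<open>plays_exp4p\<close> identifies that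
  expectation with the sampling probability.\<close>

lemma integral_arm:
  fixes f :: "nat \<Rightarrow> 'a \<Rightarrow> real"
  assumes t: "t < T" and f: "\<And>j. j < K \<Longrightarrow> f j \<in> borel_measurable (F t)"
    and B: "\<And>j \<omega>. j < K \<Longrightarrow> \<omega> \<in> space M \<Longrightarrow> \<bar>f j \<omega>\<bar> \<le> B"
  shows "integrable M (\<lambda>\<omega>. f (arm t \<omega>) \<omega>)"
    and "integrable M (\<lambda>\<omega>. \<Sum>j<K. prob_at \<omega> t j * f j \<omega>)"
    and "(\<integral>\<omega>. f (arm t \<omega>) \<omega> \<partial>M) = (\<integral>\<omega>. (\<Sum>j<K. prob_at \<omega> t j * f j \<omega>) \<partial>M)"
proof -
  interpret sub: sigma_finite_subalgebra M "F t"
  proof -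
    interpret finite_measure_subalgebra M "F t"
      by unfold_locales (rule subalgebra_F)
    show "sigma_finite_subalgebra M (F t)" ..
  qed
  define I where "I j = (indicator {\<omega> \<in> space M. arm t \<omega> = j} :: 'a \<Rightarrow> real)" for j
  have arm_meas: "arm t \<in> M \<rightarrow>\<^sub>M count_space {..<K}"
    using measurable_from_subalg[OF subalgebra_F arm_measurable[OF t]] .
  have I: "I j \<in> borel_measurable M" if "j < K" for j
  proof -
    have "arm t -` {j} \<inter> space M \<in> sets M"
      using that by (intro measurable_sets[OF arm_meas]) simp
    moreover have "arm t -` {j} \<inter> space M = {\<omega> \<in> space M. arm t \<omega> = j}"
      by auto
    ultimately show ?thesis
      by (simp add: I_def)
  qed
  have fI: "integrable M (\<lambda>\<omega>. f j \<omega> * I j \<omega>)" if "j < K" for j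
  proof (rule integrable_const_bound[where B = B])
    show "AE \<omega> in M. norm (f j \<omega> * I j \<omega>) \<le> B"
      using B[OF that] by (intro AE_I2) (force simp: I_def indicator_def split: if_splits)
    show "(\<lambda>\<omega>. f j \<omega> * I j \<omega>) \<in> borel_measurable M"
      using borel_measurable_F_M[OF f] I that by simp
  qed
  have law: "AE \<omega> in M. f j \<omega> * real_cond_exp M (F t) (I j) \<omega> = prob_at \<omega> t j * f j \<omega>" if "j < K" for j
  proof -
    have "AE \<omega> in M. real_cond_exp M (F t) (I j) \<omega> = arm_prob \<alpha> \<gamma> t j \<omega>"
      using plays t that by (simp add: plays_exp4p_def I_def)
    then show ?thesis
      by eventually_elim (simp add: arm_prob_def exp4p_env.p_def exp4p_env.w_def)
  qed
  have pf_meas: "(\<lambda>\<omega>. prob_at \<omega> t j * f j \<omega>) \<in> borel_measurable M" if "j < K" for j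
    using borel_measurable_F_M[OF f] borel_measurable_F_M[OF prob_at_measurable[OF t]] that by simp
  \<comment> \<open>Integrability is inherited from the almost everywhere equal product with the
    conditional expectation.\<close>
  have pf: "integrable M (\<lambda>\<omega>. prob_at \<omega> t j * f j \<omega>)" if "j < K" for j
    using sub.real_cond_exp_intg(1)[OF fI[OF that] f[OF that] I[OF that]]
    by (rule integrable_cong_AE_imp) (use pf_meas[OF that] law[OF that] in auto)
  have eq: "(\<integral>\<omega>. f j \<omega> * I j \<omega> \<partial>M) = (\<integral>\<omega>. prob_at \<omega> t j * f j \<omega> \<partial>M)" if "j < K" for j
  proof -
    have "(\<integral>\<omega>. prob_at \<omega> t j * f j \<omega> \<partial>M) = (\<integral>\<omega>. f j \<omega> * real_cond_exp M (F t) (I j) \<omega> \<partial>M)"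
      using borel_measurable_F_M[OF f[OF that]] law[OF that] pf_meas[OF that]
      by (intro integral_cong_AE) auto
    then show ?thesis
      using sub.real_cond_exp_intg(2)[OF fI[OF that] f[OF that] I[OF that]] by simp
  qed
  have split: "f (arm t \<omega>) \<omega> = (\<Sum>j<K. f j \<omega> * I j \<omega>)" if "\<omega> \<in> space M" for \<omega>
  proof -
    have "(\<Sum>j<K. f j \<omega> * I j \<omega>) = (\<Sum>j<K. if j = arm t \<omega> then f j \<omega> else 0)"
      using that by (intro sum.cong) (auto simp: I_def)
    then show ?thesis
      using arm_less[OF t that] by simp
  qed
  show "integrable M (\<lambda>\<omega>. f (arm t \<omega>) \<omega>)"
    by (subst Bochner_Integration.integrable_cong[OF refl split], assumption)
      (intro Bochner_Integration.integrable_sum fI, simp)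
  show "integrable M (\<lambda>\<omega>. \<Sum>j<K. prob_at \<omega> t j * f j \<omega>)"
    by (intro Bochner_Integration.integrable_sum pf) simp
  show "(\<integral>\<omega>. f (arm t \<omega>) \<omega> \<partial>M) = (\<integral>\<omega>. (\<Sum>j<K. prob_at \<omega> t j * f j \<omega>) \<partial>M)"
  proof -
    have "(\<integral>\<omega>. f (arm t \<omega>) \<omega> \<partial>M) = (\<integral>\<omega>. (\<Sum>j<K. f j \<omega> * I j \<omega>) \<partial>M)"
      by (rule Bochner_Integration.integral_cong[OF refl split])
    also have "\<dots> = (\<Sum>j<K. \<integral>\<omega>. f j \<omega> * I j \<omega> \<partial>M)"
      by (intro Bochner_Integration.integral_sum fI) simp
    also have "\<dots> = (\<Sum>j<K. \<integral>\<omega>. prob_at \<omega> t j * f j \<omega> \<partial>M)"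
      by (intro sum.cong eq) auto
    also have "\<dots> = (\<integral>\<omega>. (\<Sum>j<K. prob_at \<omega> t j * f j \<omega>) \<partial>M)"
      by (intro Bochner_Integration.integral_sum[symmetric] pf) simp
    finally show ?thesis .
  qed
qed

section \<open>The exponential supermartingale and its tail\<close>

text \<open>At \<open>t = T\<close>, staying below \<open>\<alpha> * sqrt (N * T)\<close> means
  precisely that the true gain of expert \<open>i\<close> is at most its
  \<open>upper_bound\<close>.\<close>

definition deviation :: "nat \<Rightarrow> nat \<Rightarrow> 'a \<Rightarrow> real" where
  "deviation t i \<omega> = (\<Sum>s<t. gain_at \<omega> s i - est_at \<omega> s i - bonus_at \<omega> s i)"

lemma deviation_le:
  assumes "t \<le> T" "i < N" "\<omega> \<in> space M"
  shows "deviation t i \<omega> \<le> real t"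
proof -
  interpret exp4p_path K N T \<alpha> \<gamma> "advice \<omega>" "\<lambda>s k. rew s k \<omega>" "\<lambda>s. arm s \<omega>"
    using assms by (intro path)
  have "gain s i - gain_est s i - bonus s i \<le> 1" if "s < t" for s
    using gain_le_1[of s i] gain_est_nonneg[of s i] bonus_pos[of s i] that assms by simp
  then show ?thesis
    using sum_bounded_above[of "{..<t}" "\<lambda>s. gain s i - gain_est s i - bonus s i" 1]
    by (simp add: deviation_def)
qed

lemma deviation_measurable:
  assumes "t \<le> T" "i < N"
  shows "deviation t i \<in> borel_measurable (F t)"
  unfolding deviation_def
proof (intro borel_measurable_sum borel_measurable_diff)
  fix s assume "s \<in> {..<t}"
  then have s: "s < T" "s \<le> t" "Suc s \<le> t"
    using assms by auto
  show "(\<lambda>\<omega>. gain_at \<omega> s i) \<in> borel_measurable (F t)"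
    using borel_measurable_F_mono[OF gain_at_measurable] s assms by blast
  show "(\<lambda>\<omega>. est_at \<omega> s i) \<in> borel_measurable (F t)"
    using borel_measurable_F_mono[OF est_at_measurable] s assms by blast
  show "(\<lambda>\<omega>. bonus_at \<omega> s i) \<in> borel_measurable (F t)"
    using borel_measurable_F_mono[OF bonus_at_measurable] s assms by blast
qed

text \<open>The supermartingale property in expectation: averaging the newest factor over the drawn
  arm gives at most 1 by \<open>exponential_moment\<close>. Integrability follows from the one-sided
  bound \<open>deviation_le\<close>, as \<theta> is nonnegative.\<close>

lemma exp_deviation:
  assumes "t \<le> T" "i < N" "\<theta> = \<alpha> / (2 * sqrt (real N * real T))"
  shows "integrable M (\<lambda>\<omega>. exp (\<theta> * deviation t i \<omega>))"
    and "(\<integral>\<omega>. exp (\<theta> * deviation t i \<omega>) \<partial>M) \<le> 1"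
proof -
  have \<theta>: "0 \<le> \<theta>"
    using confidence by (simp add: assms(3))
  have bounded: "exp (\<theta> * deviation t i \<omega>) \<le> exp (\<theta> * real t)"
    if "t \<le> T" "\<omega> \<in> space M" for t \<omega>
    using deviation_le[OF that(1) assms(2) that(2)] \<theta> by (simp add: mult_left_mono)
  have int: "integrable M (\<lambda>\<omega>. exp (\<theta> * deviation t i \<omega>))" if "t \<le> T" for t
    using bounded[OF that] borel_measurable_F_M[OF deviation_measurable[OF that assms(2)]]
    by (intro integrable_const_bound[where B = "exp (\<theta> * real t)"] AE_I2) auto
  show "integrable M (\<lambda>\<omega>. exp (\<theta> * deviation t i \<omega>))"
    using assms(1) by (rule int)
  show "(\<integral>\<omega>. exp (\<theta> * deviation t i \<omega>) \<partial>M) \<le> 1"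
    using assms(1)
  proof (induction t)
    case 0
    show ?case
      by (simp add: deviation_def prob_space)
  next
    case (Suc t)
    then have t: "t < T"
      by simp
    \<comment> \<open>\<open>h j\<close> is the next increment if arm \<open>j\<close> is drawn. The
      past factor is put into \<open>f j\<close>, which is still known at \<open>F t\<close>, so
      that \<open>integral_arm\<close> applies to the whole product.\<close>
    define h where "h j \<omega> = gain_at \<omega> t i - advice \<omega> t i j * rew t j \<omega> / prob_at \<omega> t j - bonus_at \<omega> t i"
      for j \<omega>
    define f where "f j \<omega> = exp (\<theta> * deviation t i \<omega>) * exp (\<theta> * h j \<omega>)" for j \<omega>
    have f_meas: "f j \<in> borel_measurable (F t)" if "j < K" for j
    proof -
      have [measurable]: "(\<lambda>\<omega>. gain_at \<omega> t i) \<in> borel_measurable (F t)"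
          "(\<lambda>\<omega>. bonus_at \<omega> t i) \<in> borel_measurable (F t)"
          "deviation t i \<in> borel_measurable (F t)"
          "(\<lambda>\<omega>. prob_at \<omega> t j) \<in> borel_measurable (F t)"
          "(\<lambda>\<omega>. advice \<omega> t i j) \<in> borel_measurable (F t)"
          "rew t j \<in> borel_measurable (F t)"
        using t assms(2) that gain_at_measurable bonus_at_measurable deviation_measurable
          prob_at_measurable advice_measurable rew_measurable by auto
      show ?thesis
        unfolding f_def h_def by measurable
    qed
    have f_bound: "\<bar>f j \<omega>\<bar> \<le> exp (\<theta> * real t) * exp (\<theta> * 1)" if "j < K" "\<omega> \<in> space M" for j \<omega>
    proof -
      interpret exp4p_path K N T \<alpha> \<gamma> "advice \<omega>" "\<lambda>s k. rew s k \<omega>" "\<lambda>s. arm s \<omega>"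
        using that by (intro path)
      have "0 \<le> advice \<omega> t i j * rew t j \<omega> / p t j"
        using e_nonneg[OF t assms(2) that(1)] x_nonneg[OF t that(1)] p_pos[OF t that(1)] by simp
      then have "h j \<omega> \<le> 1"
        using gain_le_1[OF t assms(2)] bonus_pos[of t i] by (simp add: h_def)
      then have "exp (\<theta> * h j \<omega>) \<le> exp (\<theta> * 1)"
        using \<theta> by (simp add: mult_left_le)
      then show ?thesis
        using bounded[of t \<omega>] t that by (simp add: f_def abs_mult mult_mono)
    qed
    have "(\<integral>\<omega>. exp (\<theta> * deviation (Suc t) i \<omega>) \<partial>M) = (\<integral>\<omega>. f (arm t \<omega>) \<omega> \<partial>M)"
    proof (rule Bochner_Integration.integral_cong[OF refl])
      fix \<omega> assume \<omega>: "\<omega> \<in> space M"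
      interpret exp4p_path K N T \<alpha> \<gamma> "advice \<omega>" "\<lambda>s k. rew s k \<omega>" "\<lambda>s. arm s \<omega>"
        using \<omega> by (rule path)
      show "exp (\<theta> * deviation (Suc t) i \<omega>) = f (arm t \<omega>) \<omega>"
        by (simp add: deviation_def f_def h_def gain_est_eq[OF t] distrib_left exp_add)
    qed
    also have "\<dots> = (\<integral>\<omega>. (\<Sum>j<K. prob_at \<omega> t j * f j \<omega>) \<partial>M)"
      using t f_meas f_bound by (rule integral_arm)
    also have "\<dots> \<le> (\<integral>\<omega>. exp (\<theta> * deviation t i \<omega>) \<partial>M)"
    proof (rule integral_mono)
      show "integrable M (\<lambda>\<omega>. \<Sum>j<K. prob_at \<omega> t j * f j \<omega>)"
        using t f_meas f_bound by (rule integral_arm)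
      show "integrable M (\<lambda>\<omega>. exp (\<theta> * deviation t i \<omega>))"
        using t by (intro int) simp
    next
      fix \<omega> assume \<omega>: "\<omega> \<in> space M"
      interpret exp4p_path K N T \<alpha> \<gamma> "advice \<omega>" "\<lambda>s k. rew s k \<omega>" "\<lambda>s. arm s \<omega>"
        using \<omega> by (rule path)
      have "(\<Sum>j<K. p t j * f j \<omega>) = exp (\<theta> * deviation t i \<omega>) * (\<Sum>j<K. p t j * exp (\<theta> * h j \<omega>))"
        by (simp add: f_def sum_distrib_left mult.left_commute)
      also have "\<dots> \<le> exp (\<theta> * deviation t i \<omega>) * 1"
        unfolding h_def by (intro mult_left_mono exponential_moment t assms) simp
      finally show "(\<Sum>j<K. p t j * f j \<omega>) \<le> exp (\<theta> * deviation t i \<omega>)"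
        by simp
    qed
    also have "\<dots> \<le> 1"
      using Suc by simp
    finally show ?case .
  qed
qed

text \<open>Markov's inequality for the exponential; the threshold
  \<open>\<alpha> * sqrt (N * T)\<close> scaled by \<theta> becomes half of \<alpha>
  squared.\<close>

lemma deviation_tail:
  assumes "i < N"
  shows "measure M {\<omega> \<in> space M. \<alpha> * sqrt (real N * real T) \<le> deviation T i \<omega>} \<le> exp (- \<alpha>\<^sup>2 / 2)"
proof -
  define \<theta> where "\<theta> = \<alpha> / (2 * sqrt (real N * real T))"
  have s: "0 < sqrt (real N * real T)"
    using experts horizon by simp
  have \<theta>: "0 < \<theta>"
    unfolding \<theta>_def using s confidence(1) by (intro divide_pos_pos mult_pos_pos) auto
  have \<theta>s: "\<theta> * (\<alpha> * sqrt (real N * real T)) = \<alpha>\<^sup>2 / 2"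
    using experts horizon by (simp add: \<theta>_def power2_eq_square)
  have "\<alpha> * sqrt (real N * real T) \<le> d \<longleftrightarrow> exp (\<alpha>\<^sup>2 / 2) \<le> exp (\<theta> * d)" for d
    using \<theta> unfolding \<theta>s[symmetric] by simp
  then have "measure M {\<omega> \<in> space M. \<alpha> * sqrt (real N * real T) \<le> deviation T i \<omega>}
      = measure M {\<omega> \<in> space M. exp (\<alpha>\<^sup>2 / 2) \<le> exp (\<theta> * deviation T i \<omega>)}"
    by simp
  also have "\<dots> \<le> (\<integral>\<omega>. exp (\<theta> * deviation T i \<omega>) \<partial>M) / exp (\<alpha>\<^sup>2 / 2)"
    using exp_deviation(1)[OF order_refl assms \<theta>_def]
    by (intro integral_Markov_inequality_measure[where A = "{}"]) auto
  also have "\<dots> \<le> 1 / exp (\<alpha>\<^sup>2 / 2)"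
    using exp_deviation(2)[OF order_refl assms \<theta>_def] by (intro divide_right_mono) auto
  also have "\<dots> = exp (- \<alpha>\<^sup>2 / 2)"
    unfolding inverse_eq_divide[symmetric] exp_minus[symmetric] by simp
  finally show ?thesis .
qed

section \<open>From simultaneous confidence bounds to the regret event\<close>

lemma regret_measurable: "regret \<in> borel_measurable M"
proof -
  have "gain_at \<omega> t i = (\<Sum>j<K. advice \<omega> t i j * rew t j \<omega>)" for \<omega> t i
    by (simp add: exp4p_env.gain_def)
  then have "expert_reward i \<in> borel_measurable M" if "i < N" for i
    using borel_measurable_F_M[OF gain_at_measurable] that
    by (auto simp: expert_reward_def[abs_def] intro!: borel_measurable_sum)
  moreover have "player_reward \<in> borel_measurable M"
    unfolding player_reward_def
  proof (intro borel_measurable_sum)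
    fix t assume "t \<in> {..<T}"
    then have t: "t < T"
      by simp
    show "(\<lambda>\<omega>. rew t (arm t \<omega>) \<omega>) \<in> borel_measurable M"
    \<comment> \<open>Evaluating the rewards at a random arm is measurable because there are only
      finitely many arms.\<close>
    proof (rule measurable_compose_countable'[where I = "{..<K}"])
      show "arm t \<in> M \<rightarrow>\<^sub>M count_space {..<K}"
        using measurable_from_subalg[OF subalgebra_F arm_measurable[OF t]] .
      show "rew t j \<in> borel_measurable M" if "j \<in> {..<K}" for j
        using borel_measurable_F_M[OF rew_measurable[OF t]] that by simp
    qed simp
  qed
  ultimately show ?thesis
    unfolding regret_def by (intro borel_measurable_diff borel_measurable_Max) auto
qed

lemma regret_le_if_deviations_le:
  assumes u: "uniform_expert u" and \<omega>: "\<omega> \<in> space M"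
    and dev: "\<And>i. i < N \<Longrightarrow> deviation T i \<omega> \<le> \<alpha> * sqrt (real N * real T)"
  shows "regret \<omega> \<le> 5 / 3 * \<gamma> * real T + 3 * real K * ln (real N) / \<gamma>
      + 2 * \<alpha> * sqrt (real N * real T) + 2 / 3 * \<alpha>\<^sup>2"
proof -
  interpret exp4p_path K N T \<alpha> \<gamma> "advice \<omega>" "\<lambda>s k. rew s k \<omega>" "\<lambda>s. arm s \<omega>"
    using \<omega> by (rule path)
  have "Max ((\<lambda>i. expert_reward i \<omega>) ` {..<N}) \<in> (\<lambda>i. expert_reward i \<omega>) ` {..<N}"
    using experts by (intro Max_in) auto
  then obtain k where k: "k < N" "Max ((\<lambda>i. expert_reward i \<omega>) ` {..<N}) = expert_reward k \<omega>"
    by auto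
  have "(\<Sum>t<T. gain t k) - (\<Sum>t<T. rew t (arm t \<omega>) \<omega>)
    \<le> 5 / 3 * \<gamma> * real T + 3 * real K * ln (real N) / \<gamma>
      + 2 * \<alpha> * sqrt (real N * real T) + 2 / 3 * \<alpha>\<^sup>2"
  proof (rule regret_le[where u = u])
    show "u < N"
      using u by (simp add: uniform_expert_def)
    show "advice \<omega> t u j = 1 / real K" if "t < T" "j < K" for t j
      using u that ctx_in_space[OF _ \<omega>] by (simp add: uniform_expert_def advice_def)
    show "(\<Sum>t<T. gain t i) \<le> upper_bound i" if "i < N" for i
      using dev[OF that] by (simp add: deviation_def upper_bound_def sum_subtractf sum.distrib)
  qed (fact k(1))
  then show ?thesis
    unfolding regret_def k(2) unfolding player_reward_def expert_reward_def gain_def .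
qed

lemma regret_tail:
  assumes u: "uniform_expert u"
  shows "1 - real N * exp (- \<alpha>\<^sup>2 / 2) \<le> measure M {\<omega> \<in> space M.
      regret \<omega> \<le> 5 / 3 * \<gamma> * real T + 3 * real K * ln (real N) / \<gamma>
      + 2 * \<alpha> * sqrt (real N * real T) + 2 / 3 * \<alpha>\<^sup>2}" (is "_ \<le> measure M ?R")
proof -
  \<comment> \<open>Failure events of the individual experts; outside their union all upper
    confidence bounds hold at once.\<close>
  define B where "B i = {\<omega> \<in> space M. \<alpha> * sqrt (real N * real T) \<le> deviation T i \<omega>}" for i
  have B: "B i \<in> sets M" if "i < N" for i
    using borel_measurable_F_M[OF deviation_measurable[OF order_refl that]] unfolding B_def by measurable
  have R: "?R \<in> sets M"
    using regret_measurable by measurable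
  have "measure M (\<Union>i<N. B i) \<le> (\<Sum>i<N. measure M (B i))"
    using B by (intro finite_measure_subadditive_finite) auto
  also have "\<dots> \<le> real N * exp (- \<alpha>\<^sup>2 / 2)"
    using sum_bounded_above[of "{..<N}" "\<lambda>i. measure M (B i)" "exp (- \<alpha>\<^sup>2 / 2)"] deviation_tail
    by (simp add: B_def)
  finally have "1 - real N * exp (- \<alpha>\<^sup>2 / 2) \<le> measure M (space M - (\<Union>i<N. B i))"
    using B by (subst prob_compl) auto
  also have "\<dots> \<le> measure M ?R"
  proof (rule finite_measure_mono[OF _ R])
    show "space M - (\<Union>i<N. B i) \<subseteq> ?R"
      using regret_le_if_deviations_le[OF u] unfolding B_def by force
  qed
  finally show ?thesis .
qed

end

section \<open>Parameter choice and the final bound\<close>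

theorem theorem1:
  fixes M :: "'a measure" and F :: "nat \<Rightarrow> 'a measure" and S :: "'c measure"
    and K N T :: nat
    and ctx :: "nat \<Rightarrow> 'a \<Rightarrow> 'c"
    and adv :: "nat \<Rightarrow> nat \<Rightarrow> 'c \<Rightarrow> nat \<Rightarrow> real"
    and rew :: "nat \<Rightarrow> nat \<Rightarrow> 'a \<Rightarrow> real"
    and arm :: "nat \<Rightarrow> 'a \<Rightarrow> nat"
    and \<alpha> \<gamma> \<delta> :: real
  assumes bandit: "contextual_bandit M F S K N T ctx adv rew arm"
    and "K \<ge> 2" and "N \<ge> 2" and "T > 0"
    and uniform: "\<exists>u. contextual_bandit.uniform_expert S K N T adv u"
    and rewards: "\<And>t j \<omega>. t < T \<Longrightarrow> j < K \<Longrightarrow> \<omega> \<in> space M \<Longrightarrow> 0 \<le> rew t j \<omega> \<and> rew t j \<omega> \<le> 1"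
    and "0 < \<delta>" and "\<delta> < 1"
    and \<gamma>: "\<gamma> = sqrt (3 * real K * ln (real N) / (real T * (2 * real N / 3 + 1)))"
    and "\<gamma> \<le> 1 / 2"
    and \<alpha>: "\<alpha> = 2 * sqrt (real K * ln (real N * real T / \<delta>))"
    and run: "contextual_bandit.plays_exp4p M F K N T ctx adv rew arm \<alpha> \<gamma>"
  shows "measure M {\<omega> \<in> space M.
           contextual_bandit.regret K N T ctx adv rew arm \<omega>
             \<le> 2 * sqrt (3 * real K * real T * (2 * real N / 3 + 1) * ln (real N))
               + 4 * real K * sqrt (real K * real N * real T * ln (real N * real T / \<delta>))
               + 8 * real N * real K * ln (real N * real T / \<delta>)} \<ge> 1 - \<delta>"
proof -
  interpret contextual_bandit M F S K N T ctx adv rew arm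
    by (rule bandit)
  define L where "L = ln (real N * real T / \<delta>)"
  define c where "c = 2 * real N / 3 + 1"
  define bound where "bound = 2 * sqrt (3 * real K * real T * c * ln (real N))
      + 4 * real K * sqrt (real K * real N * real T * L) + 8 * real N * real K * L"
  have NT: "2 \<le> real N * real T"
    using mult_mono[of 2 "real N" 1 "real T"] \<open>N \<ge> 2\<close> \<open>T > 0\<close> by simp
  then have "\<delta> < real N * real T"
    using \<open>\<delta> < 1\<close> by simp
  then have "1 < real N * real T / \<delta>"
    using \<open>0 < \<delta>\<close> by simp
  then have L: "0 < L"
    by (simp add: L_def)
  have lnN: "0 < ln (real N)" and c: "0 < c" "5 / 3 \<le> c"
    using \<open>N \<ge> 2\<close> by (simp_all add: c_def)
  have \<gamma>2: "\<gamma>\<^sup>2 = 3 * real K * ln (real N) / (real T * c)" and "0 < \<gamma>"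
    using lnN c \<open>K \<ge> 2\<close> \<open>T > 0\<close> by (simp_all add: \<gamma> c_def[symmetric])
  have \<alpha>2: "\<alpha>\<^sup>2 = 4 * real K * L" and "0 < \<alpha>"
    using L \<open>K \<ge> 2\<close> by (simp_all add: \<alpha> L_def[symmetric] power_mult_distrib)
  have nonneg: "0 \<le> sqrt (3 * real K * real T * c * ln (real N))"
      "0 \<le> 4 * real K * sqrt (real K * real N * real T * L)" "0 \<le> real N * real K * L"
    using L lnN c by simp_all
  have "1 - \<delta> \<le> measure M {\<omega> \<in> space M. regret \<omega> \<le> bound}"
  proof (cases "\<alpha> \<le> 2 * sqrt (real N * real T)")
    case True
    interpret exp4p_run M F S K N T ctx adv rew arm \<alpha> \<gamma>
      using \<open>K \<ge> 2\<close> \<open>N \<ge> 2\<close> \<open>T > 0\<close> rewards \<open>0 < \<gamma>\<close> \<open>\<gamma> \<le> 1 / 2\<close> \<open>0 < \<alpha>\<close> True run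
      by unfold_locales auto
    obtain u where u: "uniform_expert u"
      using uniform by blast
    \<comment> \<open>Half of \<alpha> squared is \<open>2 * K * L\<close>, which is at least
      \<open>L\<close>; the union bound over experts then costs at most
      \<open>\<delta> / T\<close>.\<close>
    have "real N * exp (- \<alpha>\<^sup>2 / 2) \<le> real N * exp (- L)"
      using L \<open>K \<ge> 2\<close> by (intro mult_left_mono) (simp_all add: \<alpha>2)
    also have "\<dots> = \<delta> / real T"
      using NT \<open>0 < \<delta>\<close> \<open>T > 0\<close> \<open>N \<ge> 2\<close> by (simp add: L_def exp_minus)
    also have "\<dots> \<le> \<delta>"
      using \<open>0 < \<delta>\<close> \<open>T > 0\<close> by (simp add: divide_le_eq)
    finally have "1 - \<delta> \<le> 1 - real N * exp (- \<alpha>\<^sup>2 / 2)"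
      by simp
    also note regret_tail[OF u]
    also have "5 / 3 * \<gamma> * real T + 3 * real K * ln (real N) / \<gamma>
      + 2 * \<alpha> * sqrt (real N * real T) + 2 / 3 * \<alpha>\<^sup>2 \<le> bound"
    proof -
      have \<gamma>2T: "\<gamma>\<^sup>2 * (real T * c) = 3 * real K * ln (real N)"
        using c \<open>T > 0\<close> by (simp add: \<gamma>2)
      \<comment> \<open>By the tuning of \<gamma>, both \<open>c * \<gamma> * T\<close> and
        \<open>3 * K * ln N / \<gamma>\<close> equal \<open>r\<close>. The former dominates the
        exploration cost because \<open>c\<close> is at least 5/3, and together they yield the
        leading term \<open>2 * r\<close>.\<close>
      define r where "r = sqrt (3 * real K * real T * c * ln (real N))"
      have "c * \<gamma> * real T = sqrt ((c * \<gamma> * real T)\<^sup>2)"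
        using c \<open>0 < \<gamma>\<close> by simp
      also have "(c * \<gamma> * real T)\<^sup>2 = (\<gamma>\<^sup>2 * (real T * c)) * (real T * c)"
        by (simp add: power2_eq_square)
      also have "\<dots> = 3 * real K * real T * c * ln (real N)"
        by (simp add: \<gamma>2T)
      finally have r: "c * \<gamma> * real T = r"
        by (simp add: r_def)
      have "3 * real K * ln (real N) / \<gamma> = r"
        using \<open>0 < \<gamma>\<close> by (simp add: r[symmetric] \<gamma>2T[symmetric] power2_eq_square)
      moreover have "5 / 3 * \<gamma> * real T \<le> r"
        unfolding r[symmetric] using c \<open>0 < \<gamma>\<close> by (intro mult_right_mono) auto
      moreover have "2 * \<alpha> * sqrt (real N * real T) \<le> 4 * real K * sqrt (real K * real N * real T * L)"
      proof -
        have "2 * \<alpha> * sqrt (real N * real T) = 4 * sqrt (real K * real N * real T * L)"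
          by (simp add: \<alpha> L_def[symmetric] real_sqrt_mult)
        also have "\<dots> \<le> 4 * real K * sqrt (real K * real N * real T * L)"
          using \<open>K \<ge> 2\<close> L by (intro mult_right_mono) auto
        finally show ?thesis .
      qed
      moreover have "2 / 3 * \<alpha>\<^sup>2 \<le> 8 * real N * real K * L"
      proof -
        have "8 / 3 * (real K * L) \<le> (8 * real N) * (real K * L)"
          using L \<open>N \<ge> 2\<close> by (intro mult_right_mono) auto
        then show ?thesis
          by (simp add: \<alpha>2)
      qed
      ultimately have "5 / 3 * \<gamma> * real T + 3 * real K * ln (real N) / \<gamma>
          + 2 * \<alpha> * sqrt (real N * real T) + 2 / 3 * \<alpha>\<^sup>2
        \<le> r + r + 4 * real K * sqrt (real K * real N * real T * L) + 8 * real N * real K * L"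
        by (intro add_mono) simp_all
      then show ?thesis
        by (simp only: bound_def r_def mult_2)
    qed
    then have "measure M {\<omega> \<in> space M. regret \<omega> \<le> 5 / 3 * \<gamma> * real T + 3 * real K * ln (real N) / \<gamma>
        + 2 * \<alpha> * sqrt (real N * real T) + 2 / 3 * \<alpha>\<^sup>2} \<le> measure M {\<omega> \<in> space M. regret \<omega> \<le> bound}"
      using regret_measurable by (intro finite_measure_mono) auto
    finally show ?thesis .
  next
    case False
    \<comment> \<open>Squaring the failed cap gives \<open>N * T \<le> K * L\<close>, so the last
      summand of the bound alone exceeds the trivial regret bound \<open>T\<close>.\<close>
    then have "(2 * sqrt (real N * real T))\<^sup>2 \<le> \<alpha>\<^sup>2"
      by (intro power_mono) auto
    then have "real N * real T \<le> real K * L"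
      by (simp add: \<alpha>2 power_mult_distrib)
    moreover have "real T \<le> real N * real T" "real K * L \<le> real N * (real K * L)"
      using \<open>N \<ge> 2\<close> L by (simp_all add: mult_le_cancel_right1 not_less)
    ultimately have "real T \<le> 8 * (real N * (real K * L))"
      using nonneg(3) by (simp add: mult.assoc)
    then have "real T \<le> bound"
      using nonneg(1,2) unfolding bound_def mult.assoc[symmetric]
      by (intro add_increasing add_nonneg_nonneg) auto
    then have "{\<omega> \<in> space M. regret \<omega> \<le> bound} = space M"
      using regret_le_horizon rewards \<open>N \<ge> 2\<close> by force
    then show ?thesis
      using \<open>0 < \<delta>\<close> by (simp add: prob_space)
  qed
  then show ?thesis
    by (simp add: bound_def L_def c_def)
qed

end
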